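(* Let $k$ be a field and $<$ a monomial preorder on $k[X]=k[x_1,\dots,x_n]$. Let $I$ be an ideal of $k[X]_<$ such that $L_<(I)$ is a prime ideal. Then $I$ is a prime ideal.
   Context: For $a\in\mathbb{N}^n$ write $x^a=x_1^{\alpha_1}\cdots x_n^{\alpha_n}$. A weak order on a set is a strict partial order for which incomparability is an equivalence relation. A monomial preorder on $k[X]$ is a weak order $<$ on the monomials such that for all $a,b,c\in\mathbb{N}^n$: $x^a<x^b$ if and only if $x^ax^c<x^bx^c$. For $f=\sum c_ax^a\in k[X]$, the leading part $L_<(f)$ is the sum of those terms $c_ax^a$ ($c_a\ne0$) such that no monomial $x^b$ occurring in $f$ satisfies $x^a<x^b$. Put $S_<=\{u\in k[X]\mid L_<(u)=1\}$ (a multiplicative set) and $k[X]_<=S_<^{-1}k[X]$. For $f\in k[X]_<$ choose $u\in S_<$ with $uf\in k[X]$ and set $L_<(f)=L_<(uf)$ (independent of $u$). For a subset $G\subseteq k[X]_<$, the leading ideal $L_<(G)$ is the ideal of $k[X]$ generated by all $L_<(f)$, $f\in G$. *)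

theory Defs
  imports
    "HOL-Library.Poly_Mapping"
    "HOL-Computational_Algebra.Fraction_Field"
    "HOL-Algebra.Algebraic_Closure_Type"
begin

text \<open>
  A monomial \<open>x\<^sup>a\<close> is identified with its exponent vector \<open>a\<close>, so multiplication of monomials
  is addition of exponents. Exponents and polynomials live in types with the countably many
  variables \<open>x\<^sub>0, x\<^sub>1, \<dots>\<close>; the polynomial ring in \<open>n\<close> variables is carved out as the subring on
  \<open>x\<^sub>0, \<dots>, x\<^sub>n\<^sub>-\<^sub>1\<close>.
\<close>

type_synonym expo = "nat \<Rightarrow>\<^sub>0 nat"
type_synonym 'k mpoly = "expo \<Rightarrow>\<^sub>0 'k"

definition expos :: "nat \<Rightarrow> expo set" where
  "expos n = {a. Poly_Mapping.keys a \<subseteq> {..<n}}"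

definition mpolys :: "nat \<Rightarrow> 'k::zero mpoly set" where
  "mpolys n = {f. Poly_Mapping.keys f \<subseteq> expos n}"

definition mpoly_ring :: "nat \<Rightarrow> 'k::field mpoly ring" where
  "mpoly_ring n = ring_of_type_algebra\<lparr>carrier := mpolys n\<rparr>"

definition weak_order_on :: "'a set \<Rightarrow> ('a \<Rightarrow> 'a \<Rightarrow> bool) \<Rightarrow> bool" where
  "weak_order_on A lt \<longleftrightarrow>
     irreflp_on A lt \<and> transp_on A lt \<and>
     equiv A {(a, b). a \<in> A \<and> b \<in> A \<and> \<not> lt a b \<and> \<not> lt b a}"

definition monomial_preorder :: "nat \<Rightarrow> (expo \<Rightarrow> expo \<Rightarrow> bool) \<Rightarrow> bool" where
  "monomial_preorder n lt \<longleftrightarrow>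
     weak_order_on (expos n) lt \<and>
     (\<forall>a\<in>expos n. \<forall>b\<in>expos n. \<forall>c\<in>expos n. lt a b \<longleftrightarrow> lt (a + c) (b + c))"

definition leading_part :: "(expo \<Rightarrow> expo \<Rightarrow> bool) \<Rightarrow> 'k::field mpoly \<Rightarrow> 'k mpoly" where
  "leading_part lt f =
     (\<Sum>a\<in>{a \<in> Poly_Mapping.keys f. \<not> (\<exists>b\<in>Poly_Mapping.keys f. lt a b)}.
       Poly_Mapping.single a (Poly_Mapping.lookup f a))"

definition lead_one :: "nat \<Rightarrow> (expo \<Rightarrow> expo \<Rightarrow> bool) \<Rightarrow> 'k::field mpoly set" where
  "lead_one n lt = {u \<in> mpolys n. leading_part lt u = 1}"

text \<open>
  The multiplicative set \<^const>\<open>lead_one\<close> does not contain \<open>0\<close> and polynomials form a domain, so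
  the localization is the subring of fractions with denominator in \<^const>\<open>lead_one\<close>.
\<close>

definition localization :: "nat \<Rightarrow> (expo \<Rightarrow> expo \<Rightarrow> bool) \<Rightarrow> 'k::field mpoly fract ring" where
  "localization n lt =
     ring_of_type_algebra\<lparr>carrier :=
       {Fraction_Field.Fract f u | f u. f \<in> mpolys n \<and> u \<in> lead_one n lt}\<rparr>"

text \<open>
  In \<open>loc_leading_part\<close> the chosen \<open>p\<close> is \<open>u f\<close> for some \<open>u\<close> in \<^const>\<open>lead_one\<close>. The result does
  not depend on the choice: see \<open>loc_leading_part_eq\<close> below.
\<close>

definition loc_leading_part ::
  "nat \<Rightarrow> (expo \<Rightarrow> expo \<Rightarrow> bool) \<Rightarrow> 'k::field mpoly fract \<Rightarrow> 'k mpoly" where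
  "loc_leading_part n lt f =
     leading_part lt (SOME p. p \<in> mpolys n \<and>
       (\<exists>u\<in>lead_one n lt. Fraction_Field.Fract u 1 * f = Fraction_Field.Fract p 1))"

definition leading_ideal ::
  "nat \<Rightarrow> (expo \<Rightarrow> expo \<Rightarrow> bool) \<Rightarrow> 'k::field mpoly fract set \<Rightarrow> 'k mpoly set" where
  "leading_ideal n lt G = Idl\<^bsub>mpoly_ring n\<^esub> (loc_leading_part n lt ` G)"


lemma expos_zero [simp]: "0 \<in> expos n"
  by (simp add: expos_def)

lemma expos_add: "a \<in> expos n \<Longrightarrow> b \<in> expos n \<Longrightarrow> a + b \<in> expos n"
  unfolding expos_def using keys_add[of a b] by blast

lemma mpolys_zero [simp]: "0 \<in> mpolys n"
  by (simp add: mpolys_def)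

lemma mpolys_one [simp]: "(1::'k::field mpoly) \<in> mpolys n"
  by (simp add: mpolys_def)

lemma mpolys_add: "f \<in> mpolys n \<Longrightarrow> g \<in> mpolys n \<Longrightarrow> f + g \<in> mpolys n"
  unfolding mpolys_def using keys_add[of f g] by blast

lemma mpolys_uminus: "(f::'k::field mpoly) \<in> mpolys n \<Longrightarrow> - f \<in> mpolys n"
  unfolding mpolys_def by (simp add: keys_def)

lemma mpolys_mult:
  "(f::'k::field mpoly) \<in> mpolys n \<Longrightarrow> g \<in> mpolys n \<Longrightarrow> f * g \<in> mpolys n"
  unfolding mpolys_def using keys_mult[of f g] expos_add by blast

lemma cring_of_type_algebra_subring:
  fixes A :: "'a::comm_ring_1 set"
  assumes "0 \<in> A" "1 \<in> A" "\<And>x y. x \<in> A \<Longrightarrow> y \<in> A \<Longrightarrow> x + y \<in> A"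
    "\<And>x. x \<in> A \<Longrightarrow> - x \<in> A" "\<And>x y. x \<in> A \<Longrightarrow> y \<in> A \<Longrightarrow> x * y \<in> A"
  shows "cring (ring_of_type_algebra\<lparr>carrier := A\<rparr>)"
proof (rule cringI)
  show "abelian_group (ring_of_type_algebra\<lparr>carrier := A\<rparr>)"
  proof (rule abelian_groupI)
    fix x assume "x \<in> carrier (ring_of_type_algebra\<lparr>carrier := A\<rparr>)"
    then show "\<exists>y\<in>carrier (ring_of_type_algebra\<lparr>carrier := A\<rparr>).
        y \<oplus>\<^bsub>ring_of_type_algebra\<lparr>carrier := A\<rparr>\<^esub> x = \<zero>\<^bsub>ring_of_type_algebra\<lparr>carrier := A\<rparr>\<^esub>"
      using assms(4)[of x] by (auto simp: ring_of_type_algebra_def intro!: bexI[of _ "- x"])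
  qed (use assms in \<open>auto simp: ring_of_type_algebra_def add_ac\<close>)
  show "Group.comm_monoid (ring_of_type_algebra\<lparr>carrier := A\<rparr>)"
    by (rule comm_monoidI) (use assms in \<open>auto simp: ring_of_type_algebra_def mult_ac\<close>)
qed (auto simp: ring_of_type_algebra_def distrib_right)

lemma cring_mpoly_ring: "cring (mpoly_ring n :: 'k::field mpoly ring)"
  unfolding mpoly_ring_def
  by (rule cring_of_type_algebra_subring)
    (auto intro: mpolys_add mpolys_uminus mpolys_mult)

lemma monomial_preorderD:
  assumes "monomial_preorder n lt"
  shows "a \<in> expos n \<Longrightarrow> \<not> lt a a"
    and "a \<in> expos n \<Longrightarrow> b \<in> expos n \<Longrightarrow> c \<in> expos n \<Longrightarrow> lt a b \<Longrightarrow> lt b c \<Longrightarrow> lt a c"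
    and "a \<in> expos n \<Longrightarrow> b \<in> expos n \<Longrightarrow> c \<in> expos n \<Longrightarrow> lt a b \<longleftrightarrow> lt (a + c) (b + c)"
proof -
  have ir: "irreflp_on (expos n) lt" and tr: "transp_on (expos n) lt"
    and ad: "\<forall>a\<in>expos n. \<forall>b\<in>expos n. \<forall>c\<in>expos n. lt a b \<longleftrightarrow> lt (a + c) (b + c)"
    using assms unfolding monomial_preorder_def weak_order_on_def by blast+
  show "a \<in> expos n \<Longrightarrow> \<not> lt a a"
    using ir by (rule irreflp_onD)
  show "a \<in> expos n \<Longrightarrow> b \<in> expos n \<Longrightarrow> c \<in> expos n \<Longrightarrow> lt a b \<Longrightarrow> lt b c \<Longrightarrow> lt a c"
    using tr by (rule transp_onD)
  show "a \<in> expos n \<Longrightarrow> b \<in> expos n \<Longrightarrow> c \<in> expos n \<Longrightarrow> lt a b \<longleftrightarrow> lt (a + c) (b + c)"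
    using ad by blast
qed

lemma lookup_leading_part:
  "Poly_Mapping.lookup (leading_part lt f) a =
     (if a \<in> Poly_Mapping.keys f \<and> \<not> (\<exists>b\<in>Poly_Mapping.keys f. lt a b) then Poly_Mapping.lookup f a else 0)"
  unfolding leading_part_def by (simp add: lookup_sum lookup_single when_def)

lemma ex_maximal_above:
  assumes mp: "monomial_preorder n lt" and "finite K" "K \<subseteq> expos n" "a \<in> K"
  shows "\<exists>m\<in>K. (m = a \<or> lt a m) \<and> \<not> (\<exists>b\<in>K. lt m b)"
proof -
  note D = monomial_preorderD[OF mp]
  show ?thesis using assms(2-4)
  proof (induction "card {b \<in> K. lt a b}" arbitrary: a rule: less_induct)
    case less
    show ?case
    proof (cases "\<exists>b\<in>K. lt a b")
      case True
      then obtain b where b: "b \<in> K" "lt a b" by blast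
      have "{c \<in> K. lt b c} \<subset> {c \<in> K. lt a c}"
        using b D(1)[of b] D(2)[of a b] less.prems by blast
      then have "card {c \<in> K. lt b c} < card {c \<in> K. lt a c}"
        using less.prems(1) by (intro psubset_card_mono) auto
      from less.hyps[OF this less.prems(1,2) b(1)] obtain m where
        m: "m \<in> K" "m = b \<or> lt b m" "\<not> (\<exists>b\<in>K. lt m b)" by blast
      moreover have "lt a m" using m b D(2)[of a b m] less.prems by blast
      ultimately show ?thesis by blast
    qed (use less.prems in blast)
  qed
qed

lemma lead_one_keys:
  assumes mp: "monomial_preorder n lt" and u: "u \<in> lead_one n lt"
  shows "Poly_Mapping.lookup u 0 = 1" "a \<in> Poly_Mapping.keys u \<Longrightarrow> a \<noteq> 0 \<Longrightarrow> lt a 0"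
proof -
  have U: "Poly_Mapping.keys u \<subseteq> expos n" and L: "leading_part lt u = 1"
    using u by (auto simp: lead_one_def mpolys_def)
  have "Poly_Mapping.lookup (leading_part lt u) 0 = 1" by (simp add: L)
  then show "Poly_Mapping.lookup u 0 = 1"
    by (auto simp: lookup_leading_part split: if_splits)
  assume a: "a \<in> Poly_Mapping.keys u" "a \<noteq> 0"
  obtain m where m: "m \<in> Poly_Mapping.keys u" "m = a \<or> lt a m" "\<not> (\<exists>b\<in>Poly_Mapping.keys u. lt m b)"
    using ex_maximal_above[OF mp finite_keys U a(1)] by blast
  then have "Poly_Mapping.lookup (leading_part lt u) m \<noteq> 0"
    by (simp add: lookup_leading_part in_keys_iff)
  then have "m = 0" unfolding L by (auto simp: lookup_one when_def split: if_splits)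
  with m a show "lt a 0" by auto
qed

lemma leading_part_add_lower:
  assumes mp: "monomial_preorder n lt" and p: "p \<in> mpolys n" and q: "q \<in> mpolys n"
    and low: "\<And>c. c \<in> Poly_Mapping.keys q \<Longrightarrow> \<exists>b\<in>Poly_Mapping.keys p. lt c b"
  shows "leading_part lt (p + q) = leading_part lt p"
proof (rule poly_mapping_eqI)
  note D = monomial_preorderD[OF mp]
  have K: "Poly_Mapping.keys p \<subseteq> expos n" "Poly_Mapping.keys q \<subseteq> expos n" using p q by (auto simp: mpolys_def)
  let ?M = "{a \<in> Poly_Mapping.keys p. \<not> (\<exists>b\<in>Poly_Mapping.keys p. lt a b)}"
  have M: "a \<notin> Poly_Mapping.keys q" "Poly_Mapping.lookup (p + q) a = Poly_Mapping.lookup p a" "a \<in> Poly_Mapping.keys (p + q)" if "a \<in> ?M" for a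
  proof -
    show *: "a \<notin> Poly_Mapping.keys q" using that low by blast
    then show **: "Poly_Mapping.lookup (p + q) a = Poly_Mapping.lookup p a" by (simp add: lookup_add in_keys_iff)
    then show "a \<in> Poly_Mapping.keys (p + q)" using that by (simp add: in_keys_iff)
  qed
  have up: "\<exists>m\<in>?M. lt c m" if c: "c \<in> expos n" "b \<in> Poly_Mapping.keys p" "lt c b" for b c
  proof -
    obtain m where m: "m \<in> ?M" "m = b \<or> lt b m"
      using ex_maximal_above[OF mp finite_keys K(1) c(2)] by blast
    then have "lt c m" using D(2)[of c b m] c K by blast
    with m show ?thesis by blast
  qed
  have kpq: "Poly_Mapping.keys (p + q) \<subseteq> Poly_Mapping.keys p \<union> Poly_Mapping.keys q" by (rule keys_add)
  have eq: "{a \<in> Poly_Mapping.keys (p + q). \<not> (\<exists>b\<in>Poly_Mapping.keys (p + q). lt a b)} = ?M"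
  proof (intro equalityI subsetI)
    fix a assume a: "a \<in> ?M"
    have "\<not> lt a c" if "c \<in> Poly_Mapping.keys (p + q)" for c
    proof
      assume ac: "lt a c"
      then have "c \<in> Poly_Mapping.keys q" using that a kpq by blast
      then obtain b where "b \<in> Poly_Mapping.keys p" "lt c b" using low by blast
      then show False using D(2)[of a c b] ac a K \<open>c \<in> Poly_Mapping.keys q\<close> by blast
    qed
    then show "a \<in> {a \<in> Poly_Mapping.keys (p + q). \<not> (\<exists>b\<in>Poly_Mapping.keys (p + q). lt a b)}"
      using M(3)[OF a] by blast
  next
    fix a assume a: "a \<in> {a \<in> Poly_Mapping.keys (p + q). \<not> (\<exists>b\<in>Poly_Mapping.keys (p + q). lt a b)}"
    show "a \<in> ?M"
    proof (rule ccontr)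
      assume "a \<notin> ?M"
      then obtain b where "b \<in> Poly_Mapping.keys p" "lt a b" using a kpq low by blast
      then obtain m where "m \<in> ?M" "lt a m" using up[of a b] a kpq K by blast
      then show False using a M(3)[of m] by blast
    qed
  qed
  fix a
  show "Poly_Mapping.lookup (leading_part lt (p + q)) a = Poly_Mapping.lookup (leading_part lt p) a"
    using M(2)[of a] eq by (simp add: lookup_leading_part set_eq_iff)
qed

lemma leading_part_lead_one_mult:
  fixes u p :: "'k::field mpoly"
  assumes mp: "monomial_preorder n lt" and u: "u \<in> lead_one n lt" and p: "p \<in> mpolys n"
  shows "leading_part lt (u * p) = leading_part lt p"
proof -
  note D = monomial_preorderD[OF mp]
  define v where "v = u - 1"
  have um: "u \<in> mpolys n" using u by (simp add: lead_one_def)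
  have vm: "v \<in> mpolys n"
    using mpolys_add[OF um mpolys_uminus[OF mpolys_one]] by (simp add: v_def)
  have v: "lt a 0" "a \<in> expos n" if "a \<in> Poly_Mapping.keys v" for a
  proof -
    have "a \<noteq> 0" using that lead_one_keys(1)[OF mp u]
      by (auto simp: v_def in_keys_iff lookup_minus)
    moreover have "a \<in> Poly_Mapping.keys u"
      using that \<open>a \<noteq> 0\<close> by (auto simp: v_def in_keys_iff lookup_minus lookup_one)
    ultimately show "lt a 0" using lead_one_keys(2)[OF mp u] by blast
    show "a \<in> expos n" using that vm by (auto simp: mpolys_def)
  qed
  have "u * p = p + v * p" by (simp add: v_def algebra_simps)
  moreover have "leading_part lt (p + v * p) = leading_part lt p"
  proof (rule leading_part_add_lower[OF mp p mpolys_mult[OF vm p]])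
    fix c assume "c \<in> Poly_Mapping.keys (v * p)"
    then obtain a b where ab: "c = a + b" "a \<in> Poly_Mapping.keys v" "b \<in> Poly_Mapping.keys p"
      using keys_mult[of v p] by blast
    then have "lt (a + b) (0 + b)"
      using D(3)[of a 0 b] v p by (auto simp: mpolys_def)
    with ab show "\<exists>b\<in>Poly_Mapping.keys p. lt c b" by auto
  qed
  ultimately show ?thesis by simp
qed

lemma lead_one_nonzero: "0 \<notin> lead_one n lt"
  by (auto simp: lead_one_def leading_part_def)

lemma lead_one_one: "monomial_preorder n lt \<Longrightarrow> (1::'k::field mpoly) \<in> lead_one n lt"
  by (auto simp: lead_one_def lookup_leading_part lookup_one when_def
      dest: monomial_preorderD(1)[OF _ expos_zero] intro!: poly_mapping_eqI)

lemma lead_one_mult: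
  "monomial_preorder n lt \<Longrightarrow> (u::'k::field mpoly) \<in> lead_one n lt \<Longrightarrow> v \<in> lead_one n lt
    \<Longrightarrow> u * v \<in> lead_one n lt"
  using leading_part_lead_one_mult[of n lt u v] mpolys_mult[of u n v]
  by (simp add: lead_one_def)

lemma cring_localization:
  assumes mp: "monomial_preorder n lt"
  shows "cring (localization n lt :: 'k::field mpoly fract ring)"
  unfolding localization_def
proof (rule cring_of_type_algebra_subring)
  let ?A = "{Fraction_Field.Fract f u | f u. f \<in> mpolys n \<and> u \<in> lead_one n lt}
    :: 'k mpoly fract set"
  have nz: "u \<noteq> 0" "u \<in> mpolys n" if "u \<in> lead_one n lt" for u :: "'k mpoly"
    using that lead_one_nonzero by (auto simp: lead_one_def leading_part_def)
  note one = lead_one_one[OF mp, where 'k = 'k]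
  show "0 \<in> ?A" using one mpolys_zero by (fastforce simp: Fraction_Field.Zero_fract_def)
  show "1 \<in> ?A" using one mpolys_one by (fastforce simp: Fraction_Field.One_fract_def)
  fix x assume "x \<in> ?A"
  then obtain f u where x: "x = Fraction_Field.Fract f u" "f \<in> mpolys n" "u \<in> lead_one n lt"
    by blast
  have "- x = Fraction_Field.Fract (- f) u" by (simp add: x)
  then show "- x \<in> ?A" using x mpolys_uminus by blast
  fix y assume "y \<in> ?A"
  then obtain g v where y: "y = Fraction_Field.Fract g v" "g \<in> mpolys n" "v \<in> lead_one n lt"
    by blast
  have "x + y = Fraction_Field.Fract (f * v + g * u) (u * v)" using x y nz by simp
  moreover have "f * v + g * u \<in> mpolys n" using x y nz by (intro mpolys_add mpolys_mult)
  ultimately show "x + y \<in> ?A" using lead_one_mult[OF mp x(3) y(3)] by blast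
  have "x * y = Fraction_Field.Fract (f * g) (u * v)" by (simp add: x y)
  then show "x * y \<in> ?A"
    using lead_one_mult[OF mp x(3) y(3)] mpolys_mult[OF x(2) y(2)] by blast
qed

lemma loc_leading_part_eq:
  fixes f :: "'k::field mpoly fract"
  assumes mp: "monomial_preorder n lt" and u: "u \<in> lead_one n lt" and p: "p \<in> mpolys n"
    and up: "Fraction_Field.Fract u 1 * f = Fraction_Field.Fract p 1"
  shows "loc_leading_part n lt f = leading_part lt p"
proof -
  define P where "P q \<longleftrightarrow> q \<in> mpolys n \<and>
    (\<exists>v\<in>lead_one n lt. Fraction_Field.Fract v 1 * f = Fraction_Field.Fract q 1)" for q
  have "P p" using u p up by (auto simp: P_def)
  then have "P (SOME q. P q)" by (rule someI)
  moreover have "leading_part lt q = leading_part lt p" if "P q" for q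
  proof -
    from that obtain v where q: "q \<in> mpolys n" and v: "v \<in> lead_one n lt"
      and vq: "Fraction_Field.Fract v 1 * f = Fraction_Field.Fract q 1" by (auto simp: P_def)
    have "Fraction_Field.Fract v 1 * Fraction_Field.Fract p 1
        = Fraction_Field.Fract u 1 * Fraction_Field.Fract q 1"
      unfolding up[symmetric] vq[symmetric] by (simp add: mult_ac)
    then have "v * p = u * q" by (simp add: Fraction_Field.eq_fract)
    then show ?thesis
      using leading_part_lead_one_mult[OF mp v p] leading_part_lead_one_mult[OF mp u q] by simp
  qed
  ultimately show ?thesis unfolding loc_leading_part_def P_def by simp
qed

lemma loc_leading_part_Fract:
  fixes u p :: "'k::field mpoly"
  assumes "monomial_preorder n lt" and u: "u \<in> lead_one n lt" and "p \<in> mpolys n"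
  shows "loc_leading_part n lt (Fraction_Field.Fract p u) = leading_part lt p"
proof -
  have "u \<noteq> 0" using u lead_one_nonzero by metis
  then have "Fraction_Field.Fract u 1 * Fraction_Field.Fract p u = Fraction_Field.Fract p 1"
    by (subst mult_fract, subst Fraction_Field.eq_fract(1)) auto
  with assms show ?thesis by (intro loc_leading_part_eq)
qed

end

theory Submission
  imports Defs
begin

text \<open>
  Let \<open>J\<close> be the set of polynomials in \<open>I\<close>. Leading parts are multiplicative, so it suffices to
  find for each polynomial \<open>f \<notin> J\<close> some \<open>r \<equiv> u f\<close> modulo \<open>J\<close> with \<open>u\<close> in the multiplicative set and
  \<open>L(r) \<notin> L(I)\<close>: if \<open>f g \<in> J\<close> but \<open>f, g \<notin> J\<close>, the product of two such elements lies in \<open>J\<close>,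
  contradicting that \<open>L(I)\<close> is prime.

  The element \<open>r\<close> is a weak normal form in the sense of Mora, found here without an algorithm. Refine
  the preorder to a total order, breaking ties by a global order. Suppose that every \<open>r\<close> in the set
  \<open>N\<close> of polynomials congruent to some \<open>u f\<close> shares its leading monomial with some \<open>g r \<in> J\<close>. By
  Dickson's lemma a finite \<open>B \<subseteq> N\<close> suffices to divide the leading monomial, together with the
  ecart (degree minus degree of the leading monomial), of any member of \<open>N\<close>. Let \<open>d\<close> bound the
  degrees of \<open>b\<close> and \<open>g b\<close> for \<open>b \<in> B\<close>, and take \<open>r \<in> N\<close> of degree at most \<open>d\<close> with least leading
  monomial \<open>x\<^sup>q lm(b)\<close>. Minimality forces \<open>x\<^sup>q \<le> 1\<close>, and then subtracting a multiple of \<open>x\<^sup>q b\<close> (if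
  \<open>x\<^sup>q < 1\<close>, so that \<open>u\<close> stays in the multiplicative set) or of \<open>g b\<close> (if \<open>x\<^sup>q = 1\<close>) lowers the
  leading monomial further while keeping the degree at most \<open>d\<close>.
\<close>

section \<open>Auxiliary facts on polynomials and ideals\<close>

lemma lookup_single_times_add:
  fixes s :: "'a::cancel_comm_monoid_add \<Rightarrow>\<^sub>0 'b::semiring_0"
  shows "Poly_Mapping.lookup (Poly_Mapping.single q c * s) (q + b) = c * Poly_Mapping.lookup s b"
  by (simp add: lookup_mult lookup_single when_mult)

lemma keys_single_times:
  fixes s :: "'a::cancel_comm_monoid_add \<Rightarrow>\<^sub>0 'b::semiring_0"
  shows "Poly_Mapping.keys (Poly_Mapping.single q c * s) \<subseteq> (+) q ` Poly_Mapping.keys s"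
  using keys_mult[of "Poly_Mapping.single q c" s] by (auto split: if_splits)

lemma poly_mapping_sum_singles:
  "(\<Sum>a\<in>Poly_Mapping.keys p. Poly_Mapping.single a (Poly_Mapping.lookup p a)) = p"
  by (rule poly_mapping_eqI) (simp add: lookup_sum lookup_single when_def in_keys_iff)

lemma mpolys_single: "a \<in> expos n \<Longrightarrow> Poly_Mapping.single a (c::'k::field) \<in> mpolys n"
  by (auto simp: mpolys_def)

lemma mpolys_diff: "(f::'k::field mpoly) \<in> mpolys n \<Longrightarrow> g \<in> mpolys n \<Longrightarrow> f - g \<in> mpolys n"
  using mpolys_add[OF _ mpolys_uminus, of f n g] by simp

text \<open>Closure under negation comes from multiplication by the constant
  \<open>- 1\<close>.\<close>

lemma ideal_mpoly_ringI:
  fixes T :: "'k::field mpoly set"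
  assumes "T \<subseteq> mpolys n" "0 \<in> T" "\<And>p q. p \<in> T \<Longrightarrow> q \<in> T \<Longrightarrow> p + q \<in> T"
    "\<And>p q. p \<in> mpolys n \<Longrightarrow> q \<in> T \<Longrightarrow> p * q \<in> T"
  shows "ideal T (mpoly_ring n)"
proof -
  interpret R: cring "mpoly_ring n :: 'k mpoly ring" by (rule cring_mpoly_ring)
  have simps: "carrier (mpoly_ring n :: 'k mpoly ring) = mpolys n"
    "p \<oplus>\<^bsub>mpoly_ring n\<^esub> q = p + q" "p \<otimes>\<^bsub>mpoly_ring n\<^esub> q = p * q" "\<zero>\<^bsub>mpoly_ring n\<^esub> = (0 :: 'k mpoly)"
    for p q :: "'k mpoly"
    by (simp_all add: mpoly_ring_def ring_of_type_algebra_def)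
  show ?thesis
  proof (rule idealI[OF R.ring_axioms])
    show "subgroup T (add_monoid (mpoly_ring n))"
    proof (rule subgroup.intro)
      fix x assume x: "x \<in> T"
      have xm: "x \<in> mpolys n" using x assms(1) by blast
      have "\<ominus>\<^bsub>mpoly_ring n\<^esub> x = - x"
        by (rule R.minus_equality) (simp_all add: simps xm mpolys_uminus)
      moreover have "(- 1) * x \<in> T" by (intro assms(4) mpolys_uminus mpolys_one x)
      ultimately show "inv\<^bsub>add_monoid (mpoly_ring n)\<^esub> x \<in> T" by (simp add: a_inv_def)
    qed (use assms(1-3) in \<open>auto simp: simps\<close>)
  next
    fix a x assume "a \<in> T" "x \<in> carrier (mpoly_ring n :: 'k mpoly ring)"
    then have "x * a \<in> T" by (intro assms(4)) (simp_all add: simps)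
    then show "x \<otimes>\<^bsub>mpoly_ring n\<^esub> a \<in> T" "a \<otimes>\<^bsub>mpoly_ring n\<^esub> x \<in> T"
      by (simp_all add: simps mult.commute[of a x])
  qed
qed

section \<open>Divisibility of exponents and Dickson's lemma\<close>

lemma expo_not_less_zero: "\<not> a < (0 :: expo)"
  by transfer (auto simp: less_fun_def)

lemma expo_divides:
  assumes "a \<in> expos n" "b \<in> expos n" and le: "\<And>i. i < n \<Longrightarrow> Poly_Mapping.lookup a i \<le> Poly_Mapping.lookup b i"
  obtains q where "q \<in> expos n" "b = q + a"
proof
  have zero: "Poly_Mapping.lookup a i = 0" "Poly_Mapping.lookup b i = 0" if "\<not> i < n" for i
    using assms(1,2) that by (auto simp: expos_def subset_iff in_keys_iff)
  show "b = (b - a) + a"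
  proof (rule poly_mapping_eqI)
    fix i show "Poly_Mapping.lookup b i = Poly_Mapping.lookup (b - a + a) i"
      using le[of i] zero[of i] by (cases "i < n") (auto simp: lookup_add lookup_minus)
  qed
  show "b - a \<in> expos n"
    using zero(2) by (auto simp: expos_def subset_iff in_keys_iff lookup_minus intro: ccontr)
qed

text \<open>Induction on the number of coordinates. A finite \<open>B\<close> that serves the first
  \<open>n\<close> coordinates also serves every \<open>a\<close> whose last coordinate is at least
  the maximum \<open>M\<close> over \<open>B\<close>; the finitely many smaller values are treated
  slice by slice. The map \<open>v\<close> allows vectors of data attached to polynomials to be
  compared directly.\<close>

lemma dickson:
  fixes v :: "'a \<Rightarrow> nat \<Rightarrow> nat"
  shows "\<exists>B\<subseteq>A. finite B \<and> (\<forall>a\<in>A. \<exists>b\<in>B. \<forall>i<n. v b i \<le> v a i)"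
proof (induction n arbitrary: A)
  case 0
  show ?case
  proof (cases "A = {}")
    case True
    then show ?thesis by (intro exI[of _ "{}"]) simp
  next
    case False
    then obtain a where "a \<in> A" by blast
    then show ?thesis by (intro exI[of _ "{a}"]) auto
  qed
next
  case (Suc n)
  from Suc.IH[of A] obtain B
    where B: "B \<subseteq> A" "finite B" "\<forall>a\<in>A. \<exists>b\<in>B. \<forall>i<n. v b i \<le> v a i"
    by (elim exE conjE)
  define M where "M = Max ((\<lambda>b. v b n) ` B)"
  define slice where "slice k = {a\<in>A. v a n = k}" for k
  have "\<forall>k. \<exists>C. C \<subseteq> slice k \<and> finite C \<and> (\<forall>a\<in>slice k. \<exists>b\<in>C. \<forall>i<n. v b i \<le> v a i)"
    by (rule allI) (rule Suc.IH)
  from choice[OF this] obtain C where C0: "\<forall>k. C k \<subseteq> slice k \<and> finite (C k) \<and>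
      (\<forall>a\<in>slice k. \<exists>b\<in>C k. \<forall>i<n. v b i \<le> v a i)" ..
  note C = C0[rule_format, THEN conjunct1] C0[rule_format, THEN conjunct2, THEN conjunct1]
    C0[rule_format, THEN conjunct2, THEN conjunct2, THEN bspec]
  show ?case
  proof (intro exI[of _ "B \<union> (\<Union>k<M. C k)"] conjI ballI)
    fix a assume a: "a \<in> A"
    show "\<exists>b\<in>B \<union> (\<Union>k<M. C k). \<forall>i<Suc n. v b i \<le> v a i"
    proof (cases "v a n < M")
      case True
      obtain b where b: "b \<in> C (v a n)" "\<forall>i<n. v b i \<le> v a i"
        using C(3)[of a "v a n"] a by (auto simp: slice_def)
      then have "v b n = v a n" using C(1)[of "v a n"] by (auto simp: slice_def)
      with b show ?thesis using True by (intro bexI[of _ b]) (auto simp: less_Suc_eq)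
    next
      case False
      obtain b where b: "b \<in> B" "\<forall>i<n. v b i \<le> v a i" using B(3) a by blast
      then have "v b n \<le> M" using B(2) by (auto simp: M_def)
      with b False show ?thesis by (intro bexI[of _ b]) (auto simp: less_Suc_eq)
    qed
  next
    show "B \<union> (\<Union>k<M. C k) \<subseteq> A" using B(1) C(1) by (auto simp: slice_def)
    show "finite (B \<union> (\<Union>k<M. C k))" using B(2) C(2) by simp
  qed
qed

section \<open>Total degrees\<close>

definition edeg :: "nat \<Rightarrow> expo \<Rightarrow> nat" where
  "edeg n a = (\<Sum>i<n. Poly_Mapping.lookup a i)"

text \<open>The inserted \<open>0\<close> gives the zero polynomial degree \<open>0\<close>.\<close>

definition pdeg :: "nat \<Rightarrow> 'k::zero mpoly \<Rightarrow> nat" where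
  "pdeg n p = Max (insert 0 (edeg n ` Poly_Mapping.keys p))"

lemma edeg_add: "edeg n (a + b) = edeg n a + edeg n b"
  by (simp add: edeg_def lookup_add sum.distrib)

lemma pdeg_le_iff: "pdeg n p \<le> d \<longleftrightarrow> (\<forall>a\<in>Poly_Mapping.keys p. edeg n a \<le> d)"
  by (simp add: pdeg_def)

lemma edeg_le_pdeg: "a \<in> Poly_Mapping.keys p \<Longrightarrow> edeg n a \<le> pdeg n p"
  using pdeg_le_iff by blast

text \<open>The preorder may have infinite descending chains; bounding the degree is what makes a
  least leading monomial available.\<close>

lemma finite_expos_edeg_le: "finite {a \<in> expos n. edeg n a \<le> d}"
proof (rule finite_subset)
  let ?F = "{f. \<forall>i. (i \<in> {..<n} \<longrightarrow> f i \<in> {..d}) \<and> (i \<notin> {..<n} \<longrightarrow> f i = (0::nat))}"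
  have "inj (Poly_Mapping.lookup :: expo \<Rightarrow> nat \<Rightarrow> nat)"
    by (rule injI) (simp only: poly_mapping_eq_iff)
  with finite_set_of_finite_funs[OF finite_lessThan finite_atMost]
  show "finite ((Poly_Mapping.lookup :: expo \<Rightarrow> nat \<Rightarrow> nat) -` ?F)"
    by (rule finite_vimageI)
  show "{a \<in> expos n. edeg n a \<le> d} \<subseteq> Poly_Mapping.lookup -` ?F"
  proof
    fix a assume a: "a \<in> {a \<in> expos n. edeg n a \<le> d}"
    have "Poly_Mapping.lookup a i \<le> d" if "i < n" for i
      using member_le_sum[of i "{..<n}" "Poly_Mapping.lookup a"] that a by (simp add: edeg_def)
    moreover have "Poly_Mapping.lookup a i = 0" if "\<not> i < n" for i
      using a that by (auto simp: expos_def subset_iff in_keys_iff)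
    ultimately show "a \<in> Poly_Mapping.lookup -` ?F" by simp
  qed
qed

section \<open>Refinement of the preorder to a total order\<close>

text \<open>
  The order on \<^typ>\<open>expo\<close> breaking the ties is lexicographic with least element \<open>0\<close>, so that
  \<open>a\<close> precedes \<open>0\<close> in the refinement only if \<open>lt a 0\<close>.
\<close>

definition refine :: "(expo \<Rightarrow> expo \<Rightarrow> bool) \<Rightarrow> expo \<Rightarrow> expo \<Rightarrow> bool" where
  "refine lt a b \<longleftrightarrow> lt a b \<or> (\<not> lt b a \<and> a < b)"

lemma refine_total:
  "a \<noteq> b \<Longrightarrow> refine lt a b \<or> refine lt b a"
  by (auto simp: refine_def)

text \<open>The leading monomial for the refined order. As a relation it needs no default value for
  the zero polynomial.\<close>

definition is_lead :: "(expo \<Rightarrow> expo \<Rightarrow> bool) \<Rightarrow> 'k::zero mpoly \<Rightarrow> expo \<Rightarrow> bool" where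
  "is_lead lt p a \<longleftrightarrow> a \<in> Poly_Mapping.keys p \<and> (\<forall>b\<in>Poly_Mapping.keys p. b \<noteq> a \<longrightarrow> refine lt b a)"

context
  fixes n :: nat and lt :: "expo \<Rightarrow> expo \<Rightarrow> bool"
  assumes mp: "monomial_preorder n lt"
begin

text \<open>Transitivity of incomparability in its usable form: if both alternatives failed,
  \<open>b\<close> would be incomparable to \<open>a\<close> and to \<open>c\<close>, hence
  \<open>a\<close> to \<open>c\<close>.\<close>

lemma lt_cotrans:
  assumes "a \<in> expos n" "b \<in> expos n" "c \<in> expos n" "lt a c"
  shows "lt a b \<or> lt b c"
proof (rule ccontr)
  assume no: "\<not> (lt a b \<or> lt b c)"
  note D = monomial_preorderD[OF mp]
  define R where "R = {(a, b). a \<in> expos n \<and> b \<in> expos n \<and> \<not> lt a b \<and> \<not> lt b a}"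
  have "trans R"
    using mp by (simp add: monomial_preorder_def weak_order_on_def equiv_def R_def)
  moreover have "(a, b) \<in> R" "(b, c) \<in> R"
    using no assms D(2)[of b a c] D(2)[of a c b] by (auto simp: R_def)
  ultimately have "(a, c) \<in> R" by (rule transD)
  with assms show False by (simp add: R_def)
qed

text \<open>Read \<open>\<not> lt d c\<close> as a weak inequality from \<open>c\<close> to
  \<open>d\<close>; cotransitivity passes from \<open>b + c\<close> to \<open>b + d\<close>.\<close>

lemma lt_add_mono:
  assumes "a \<in> expos n" "b \<in> expos n" "c \<in> expos n" "d \<in> expos n" "lt a b" "\<not> lt d c"
  shows "lt (a + c) (b + d)"
proof -
  note D = monomial_preorderD[OF mp]
  have "lt (a + c) (b + c)" using D(3)[of a b c] assms by blast
  moreover have "\<not> lt (b + d) (b + c)" using D(3)[of d c b] assms by (simp add: add.commute)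
  ultimately show ?thesis
    using lt_cotrans[of "a + c" "b + d" "b + c"] assms expos_add by blast
qed

lemma not_lt_add_mono:
  assumes "a \<in> expos n" "b \<in> expos n" "c \<in> expos n" "d \<in> expos n" "\<not> lt b a" "\<not> lt d c"
  shows "\<not> lt (b + d) (a + c)"
proof
  note D = monomial_preorderD[OF mp]
  assume "lt (b + d) (a + c)"
  then have "lt (b + d) (b + c) \<or> lt (b + c) (a + c)"
    using lt_cotrans[of "b + d" "b + c" "a + c"] assms expos_add by blast
  then show False
    using D(3)[of d c b] D(3)[of b a c] assms by (auto simp: add.commute)
qed

lemma refine_irrefl: "a \<in> expos n \<Longrightarrow> \<not> refine lt a a"
  using monomial_preorderD(1)[OF mp] by (auto simp: refine_def)

text \<open>By cotransitivity a strict step of \<open>lt\<close> stays strict when combined with a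
  tie, and two ties give a tie, which the global order decides.\<close>

lemma refine_trans:
  assumes "a \<in> expos n" "b \<in> expos n" "c \<in> expos n" "refine lt a b" "refine lt b c"
  shows "refine lt a c"
proof -
  have "lt a c \<or> lt c b" if "lt a b" by (rule lt_cotrans) (use that assms in auto)
  moreover have "lt b a \<or> lt a c" if "lt b c" by (rule lt_cotrans) (use that assms in auto)
  moreover have "lt c b \<or> lt b a" if "lt c a" by (rule lt_cotrans) (use that assms in auto)
  moreover have "\<not> lt c b" "\<not> lt b a"
    using assms monomial_preorderD(1,2)[OF mp] unfolding refine_def by metis+
  moreover have "a < c" if "a < b" "b < c" using that by (rule less_trans)
  ultimately show ?thesis using assms(4,5) unfolding refine_def by metis
qed

lemma refine_add_iff:
  assumes "a \<in> expos n" "b \<in> expos n" "c \<in> expos n"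
  shows "refine lt (c + a) (c + b) \<longleftrightarrow> refine lt a b"
proof -
  have "lt (c + a) (c + b) \<longleftrightarrow> lt a b" "lt (c + b) (c + a) \<longleftrightarrow> lt b a"
    unfolding add.commute[of c] using monomial_preorderD(3)[OF mp] assms by metis+
  then show ?thesis by (simp only: refine_def add_less_cancel_left)
qed

lemma refine_on:
  assumes "K \<subseteq> expos n"
  shows "transp_on K (refine lt)" "asymp_on K (refine lt)" "totalp_on K (refine lt)"
proof -
  show "transp_on K (refine lt)"
  proof (rule transp_onI)
    fix a b c assume "a \<in> K" "b \<in> K" "c \<in> K" "refine lt a b" "refine lt b c"
    with assms show "refine lt a c" by (intro refine_trans[of a b c]) auto
  qed
  show "asymp_on K (refine lt)"
  proof (rule asymp_onI)
    fix a b assume ab: "a \<in> K" "b \<in> K" "refine lt a b"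
    with assms show "\<not> refine lt b a"
      using refine_trans[of a b a] refine_irrefl[of a] by auto
  qed
  show "totalp_on K (refine lt)"
  proof (rule totalp_onI)
    fix a b assume "a \<in> K" "b \<in> K" "a \<noteq> b"
    with assms show "refine lt a b \<or> refine lt b a" by (intro refine_total) auto
  qed
qed

lemma is_lead_exists:
  assumes "p \<in> mpolys n" "p \<noteq> 0"
  shows "\<exists>a. is_lead lt p a"
proof -
  have K: "Poly_Mapping.keys p \<subseteq> expos n" and ne: "Poly_Mapping.keys p \<noteq> {}"
    using assms by (auto simp: mpolys_def)
  show ?thesis
    using Finite_Set.bex_greatest_element[OF finite_keys ne refine_on(1)[OF K] refine_on(3)[OF K]]
    by (auto simp: is_lead_def)
qed

section \<open>Cancellation of leading terms\<close>

text \<open>The scalar makes the coefficients at \<open>q + a\<close> cancel. All other monomials of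
  \<open>r\<close> and of the shifted \<open>g\<close> lie below \<open>q + a\<close>, since the
  refinement is invariant under translation.\<close>

lemma refine_cancel_lead:
  fixes r g :: "'k::field mpoly"
  assumes r: "r \<in> mpolys n" "is_lead lt r (q + a)" and g: "g \<in> mpolys n" "is_lead lt g a"
    and q: "q \<in> expos n"
    and b: "b \<in> Poly_Mapping.keys (r - Poly_Mapping.single q
      (Poly_Mapping.lookup r (q + a) / Poly_Mapping.lookup g a) * g)"
  shows "refine lt b (q + a)"
proof -
  let ?c = "Poly_Mapping.lookup r (q + a) / Poly_Mapping.lookup g a"
  have "Poly_Mapping.lookup g a \<noteq> 0" using g(2) by (simp add: is_lead_def in_keys_iff)
  then have ne: "b \<noteq> q + a"
    using b by (auto simp: in_keys_iff lookup_minus lookup_single_times_add)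
  have "b \<in> Poly_Mapping.keys r \<or> b \<in> (+) q ` Poly_Mapping.keys g"
    using b keys_diff[of r "Poly_Mapping.single q ?c * g"] keys_single_times[of q ?c g] by blast
  then show ?thesis
  proof
    assume "b \<in> Poly_Mapping.keys r" then show ?thesis using r ne by (simp add: is_lead_def)
  next
    assume "b \<in> (+) q ` Poly_Mapping.keys g"
    then obtain k where k: "b = q + k" "k \<in> Poly_Mapping.keys g" by blast
    then have "refine lt k a" using g ne by (auto simp: is_lead_def)
    then show ?thesis using refine_add_iff[of k a q] k g q by (auto simp: is_lead_def mpolys_def)
  qed
qed

text \<open>The monomials of \<open>v\<close> are \<open>0\<close> or below \<open>0\<close>, so
  shifting by \<open>q\<close> puts them strictly below \<open>0\<close>. This keeps the multiplier
  of \<open>f\<close> in the multiplicative set during a reduction.\<close>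

lemma lead_one_diff:
  fixes u v :: "'k::field mpoly"
  assumes u: "u \<in> lead_one n lt" and v: "v \<in> lead_one n lt" and q: "q \<in> expos n" "lt q 0"
  shows "u - Poly_Mapping.single q c * v \<in> lead_one n lt"
proof -
  let ?w = "Poly_Mapping.single q c * v"
  have um: "u \<in> mpolys n" and vm: "v \<in> mpolys n" using u v by (auto simp: lead_one_def)
  have w: "?w \<in> mpolys n" using vm q by (simp add: mpolys_mult mpolys_single)
  have "leading_part lt (u + - ?w) = leading_part lt u"
  proof (rule leading_part_add_lower[OF mp um mpolys_uminus[OF w]])
    fix k assume "k \<in> Poly_Mapping.keys (- ?w)"
    then obtain l where l: "k = q + l" "l \<in> Poly_Mapping.keys v"
      using keys_single_times[of q c v] by (auto simp: in_keys_iff)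
    then have "l \<in> expos n" "l = 0 \<or> lt l 0"
      using vm lead_one_keys(2)[OF mp v] by (auto simp: mpolys_def)
    then have "\<not> lt 0 l" "l \<in> expos n"
      using monomial_preorderD(1,2)[OF mp] expos_zero by metis+
    then have "lt k 0" using lt_add_mono[of q 0 l 0] q l by simp
    moreover have "0 \<in> Poly_Mapping.keys u"
      using lead_one_keys(1)[OF mp u] by (simp add: in_keys_iff)
    ultimately show "\<exists>b\<in>Poly_Mapping.keys u. lt k b" by blast
  qed
  then show ?thesis using u mpolys_diff[OF um w] by (simp add: lead_one_def)
qed

section \<open>Multiplicativity of leading parts\<close>

text \<open>The monomials in the product of the leading parts form part of one incomparability
  class, and all other contributions to \<open>f * g\<close> lie strictly below that class.\<close>

lemma leading_part_mult:
  fixes f g :: "'k::field mpoly"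
  assumes f: "f \<in> mpolys n" and g: "g \<in> mpolys n"
  shows "leading_part lt (f * g) = leading_part lt f * leading_part lt g"
proof (cases "f = 0 \<or> g = 0")
  case True
  then show ?thesis by (auto simp: leading_part_def)
next
  case False
  note D = monomial_preorderD[OF mp]
  define p where "p = leading_part lt f"
  define q where "q = leading_part lt g"
  \<comment> \<open>The leading part of \<open>h\<close> lies in the class of a single monomial
    \<open>m\<close>, and the rest of \<open>h\<close> lies strictly below \<open>m\<close>.\<close>
  have split: "\<exists>m\<in>Poly_Mapping.keys h. Poly_Mapping.keys (leading_part lt h) \<subseteq> expos n \<and>
      m \<in> Poly_Mapping.keys (leading_part lt h) \<and>
      (\<forall>a\<in>Poly_Mapping.keys (leading_part lt h). \<not> lt a m \<and> \<not> lt m a) \<and>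
      (\<forall>a\<in>Poly_Mapping.keys (h - leading_part lt h). a \<in> expos n \<and> lt a m)"
    if h: "h \<in> mpolys n" "h \<noteq> 0" for h :: "'k mpoly"
  proof -
    have K: "Poly_Mapping.keys h \<subseteq> expos n" using h by (simp add: mpolys_def)
    obtain a where "a \<in> Poly_Mapping.keys h" using h by fastforce
    then obtain m where m: "m \<in> Poly_Mapping.keys h" "\<not> (\<exists>b\<in>Poly_Mapping.keys h. lt m b)"
      using ex_maximal_above[OF mp finite_keys K] by blast
    have L: "a \<in> Poly_Mapping.keys (leading_part lt h) \<longleftrightarrow>
        a \<in> Poly_Mapping.keys h \<and> \<not> (\<exists>b\<in>Poly_Mapping.keys h. lt a b)" for a
      by (simp add: in_keys_iff lookup_leading_part)
    have R: "a \<in> Poly_Mapping.keys (h - leading_part lt h) \<longleftrightarrow>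
        a \<in> Poly_Mapping.keys h \<and> (\<exists>b\<in>Poly_Mapping.keys h. lt a b)" for a
      by (auto simp: in_keys_iff lookup_leading_part lookup_minus)
    have "lt a m" if "a \<in> Poly_Mapping.keys h" "b \<in> Poly_Mapping.keys h" "lt a b" for a b
      using lt_cotrans[of a m b] that m K by blast
    then show ?thesis using m K by (intro bexI[of _ m] conjI ballI subsetI) (auto simp: L R)
  qed
  obtain a0 where a0: "a0 \<in> Poly_Mapping.keys p" "Poly_Mapping.keys p \<subseteq> expos n"
      "\<And>a. a \<in> Poly_Mapping.keys p \<Longrightarrow> \<not> lt a a0 \<and> \<not> lt a0 a"
      "\<And>a. a \<in> Poly_Mapping.keys (f - p) \<Longrightarrow> a \<in> expos n \<and> lt a a0"
    using split[OF f] False unfolding p_def by blast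
  obtain b0 where b0: "b0 \<in> Poly_Mapping.keys q" "Poly_Mapping.keys q \<subseteq> expos n"
      "\<And>a. a \<in> Poly_Mapping.keys q \<Longrightarrow> \<not> lt a b0 \<and> \<not> lt b0 a"
      "\<And>a. a \<in> Poly_Mapping.keys (g - q) \<Longrightarrow> a \<in> expos n \<and> lt a b0"
    using split[OF g] False unfolding q_def by blast
  have ab: "a0 \<in> expos n" "b0 \<in> expos n" "a0 + b0 \<in> expos n" using a0 b0 expos_add by blast+
  have pq: "p \<in> mpolys n" "q \<in> mpolys n" using a0 b0 by (auto simp: mpolys_def)
  have hom: "c \<in> expos n \<and> \<not> lt c (a0 + b0) \<and> \<not> lt (a0 + b0) c"
    if "c \<in> Poly_Mapping.keys (p * q)" for c
  proof -
    obtain a b where c: "c = a + b" "a \<in> Poly_Mapping.keys p" "b \<in> Poly_Mapping.keys q"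
      using \<open>c \<in> _\<close> keys_mult[of p q] by blast
    then have "a \<in> expos n" "b \<in> expos n" using a0 b0 by blast+
    then show ?thesis using c a0(3)[of a] b0(3)[of b] ab expos_add
        not_lt_add_mono[of a a0 b b0] not_lt_add_mono[of a0 a b0 b] by blast
  qed
  \<comment> \<open>Polynomials over a field have no zero divisors. The monomial \<open>h\<close>
    obtained from this will dominate the lower contributions.\<close>
  have "p * q \<noteq> 0" using a0(1) b0(1) by auto
  then obtain h where h: "h \<in> Poly_Mapping.keys (p * q)" by fastforce
  have "f * g = p * q + (p * (g - q) + (f - p) * g)" by (simp add: algebra_simps)
  moreover have "leading_part lt (p * q + (p * (g - q) + (f - p) * g)) = leading_part lt (p * q)"
  proof (rule leading_part_add_lower[OF mp])
    show "p * q \<in> mpolys n" "p * (g - q) + (f - p) * g \<in> mpolys n"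
      by (intro mpolys_add mpolys_mult mpolys_diff pq f g)+
    fix c assume "c \<in> Poly_Mapping.keys (p * (g - q) + (f - p) * g)"
    then have "c \<in> Poly_Mapping.keys (p * (g - q)) \<or> c \<in> Poly_Mapping.keys ((f - p) * g)"
      using keys_add[of "p * (g - q)" "(f - p) * g"] by blast
    then have "c \<in> expos n \<and> lt c (a0 + b0)"
    proof
      assume "c \<in> Poly_Mapping.keys (p * (g - q))"
      then obtain a b where c: "c = a + b" "a \<in> Poly_Mapping.keys p" "b \<in> Poly_Mapping.keys (g - q)"
        using keys_mult[of p "g - q"] by blast
      then have "lt (b + a) (b0 + a0)" "a \<in> expos n" "b \<in> expos n"
        using lt_add_mono[of b b0 a a0] c a0(2) a0(3)[of a] b0(4)[of b] ab by blast+
      then show ?thesis using c expos_add by (simp add: add.commute)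
    next
      assume "c \<in> Poly_Mapping.keys ((f - p) * g)"
      then obtain a b where c: "c = a + b" "a \<in> Poly_Mapping.keys (f - p)" "b \<in> Poly_Mapping.keys g"
        using keys_mult[of "f - p" g] by blast
      have "b \<in> Poly_Mapping.keys q \<or> b \<in> Poly_Mapping.keys (g - q)"
        using c(3) by (auto simp: in_keys_iff lookup_minus)
      then have "\<not> lt b0 b" "b \<in> expos n"
        using b0(2,3,4) ab D(1)[of b0] D(2)[of b0 b b0] by blast+
      then have "lt (a + b) (a0 + b0)" "a \<in> expos n" using lt_add_mono[of a a0 b b0] c a0(4)[of a] ab by blast+
      then show ?thesis using c expos_add \<open>b \<in> expos n\<close> by simp
    qed
    then have "lt c h" using lt_cotrans[of c h "a0 + b0"] hom[OF h] ab by blast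
    with h show "\<exists>b\<in>Poly_Mapping.keys (p * q). lt c b" by blast
  qed
  moreover have "leading_part lt (p * q) = p * q"
  proof (rule poly_mapping_eqI)
    have "\<not> lt c d" if "c \<in> Poly_Mapping.keys (p * q)" "d \<in> Poly_Mapping.keys (p * q)" for c d
      using lt_cotrans[of c "a0 + b0" d] hom[OF that(1)] hom[OF that(2)] ab by blast
    then show "Poly_Mapping.lookup (leading_part lt (p * q)) c = Poly_Mapping.lookup (p * q) c" for c
      by (auto simp: lookup_leading_part in_keys_iff)
  qed
  ultimately show ?thesis by (simp add: p_def q_def)
qed

section \<open>Existence of weak normal forms\<close>

text \<open>\<open>J\<close> stands for the contraction of an ideal of the localization;
  \<open>sat\<close> records that members of the multiplicative set become units there.\<close>

lemma ex_lead_not_in: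
  fixes f :: "'k::field mpoly"
  assumes J: "J \<subseteq> mpolys n" "\<And>p q. p \<in> J \<Longrightarrow> q \<in> J \<Longrightarrow> p + q \<in> J"
      "\<And>p q. p \<in> mpolys n \<Longrightarrow> q \<in> J \<Longrightarrow> p * q \<in> J" "0 \<in> J"
    and sat: "\<And>u p. u \<in> lead_one n lt \<Longrightarrow> p \<in> mpolys n \<Longrightarrow> u * p \<in> J \<Longrightarrow> p \<in> J"
    and f: "f \<in> mpolys n" "f \<notin> J"
  shows "\<exists>r\<in>mpolys n. r \<noteq> 0 \<and> (\<exists>u\<in>lead_one n lt. r - u * f \<in> J) \<and>
    (\<forall>a. is_lead lt r a \<longrightarrow> \<not> (\<exists>g\<in>J. is_lead lt g a))"
proof (rule ccontr)
  assume contra: "\<not> ?thesis"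
  have Jdiff: "p - q \<in> J" if "p \<in> J" "q \<in> J" for p q
    using J(2)[OF that(1) J(3)[OF mpolys_uminus[OF mpolys_one] that(2)]] by simp
  define N where "N = {r \<in> mpolys n. \<exists>u\<in>lead_one n lt. r - u * f \<in> J}"
  \<comment> \<open>If \<open>0\<close> were in \<open>N\<close>, some \<open>u * f\<close> would
    lie in \<open>J\<close>, and saturation would put \<open>f\<close> into
    \<open>J\<close>.\<close>
  have N0: "r \<noteq> 0" if r: "r \<in> N" for r
  proof
    assume "r = 0"
    then obtain u where u: "u \<in> lead_one n lt" "- (u * f) \<in> J" using r by (auto simp: N_def)
    have "u * f \<in> J" using Jdiff[OF J(4) u(2)] by simp
    then show False using sat[OF u(1) f(1)] f(2) by blast
  qed
  have "\<forall>r\<in>N. \<exists>a g. is_lead lt r a \<and> g \<in> J \<and> is_lead lt g a"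
  proof
    fix r assume r: "r \<in> N"
    then have "r \<in> mpolys n" "\<exists>u\<in>lead_one n lt. r - u * f \<in> J" by (auto simp: N_def)
    then show "\<exists>a g. is_lead lt r a \<and> g \<in> J \<and> is_lead lt g a" using contra N0[OF r] by metis
  qed
  then obtain lm g where lm: "\<And>r. r \<in> N \<Longrightarrow> is_lead lt r (lm r)"
    and g: "\<And>r. r \<in> N \<Longrightarrow> g r \<in> J" "\<And>r. r \<in> N \<Longrightarrow> is_lead lt (g r) (lm r)"
    by metis
  have lm_expos: "lm r \<in> expos n" if "r \<in> N" for r
    using lm[OF that] that by (auto simp: is_lead_def N_def mpolys_def)
  \<comment> \<open>Coordinates below \<open>n\<close> are the exponents of the leading monomial;
    coordinate \<open>n\<close> is the ecart, which is why Dickson's lemma is applied with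
    \<open>Suc n\<close>.\<close>
  define v where "v r i = (if i < n then Poly_Mapping.lookup (lm r) i else pdeg n r - edeg n (lm r))"
    for r i
  from dickson[of N "Suc n" v] obtain B where B: "B \<subseteq> N" "finite B"
    "\<forall>r\<in>N. \<exists>b\<in>B. \<forall>i<Suc n. v b i \<le> v r i"
    by (elim exE conjE)
  define d where "d = Max ((\<lambda>b. max (pdeg n b) (pdeg n (g b))) ` B)"
  have d: "pdeg n b \<le> d" "pdeg n (g b) \<le> d" if "b \<in> B" for b
  proof -
    have "max (pdeg n b) (pdeg n (g b)) \<le> d" unfolding d_def using B(2) that by (intro Max_ge) auto
    then show "pdeg n b \<le> d" "pdeg n (g b) \<le> d" by auto
  qed
  define Nd where "Nd = {r \<in> N. pdeg n r \<le> d}"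
  have BNd: "b \<in> Nd" if "b \<in> B" for b using that B(1) d(1)[OF that] by (auto simp: Nd_def)
  have fin: "finite (lm ` Nd)"
  proof (rule finite_subset[OF _ finite_expos_edeg_le[of n d]])
    show "lm ` Nd \<subseteq> {a \<in> expos n. edeg n a \<le> d}"
    proof
      fix a assume "a \<in> lm ` Nd"
      then obtain r where r: "a = lm r" "r \<in> N" "pdeg n r \<le> d" by (auto simp: Nd_def)
      then have "edeg n a \<le> pdeg n r" using lm[OF r(2)] by (auto simp: is_lead_def intro: edeg_le_pdeg)
      then show "a \<in> {a \<in> expos n. edeg n a \<le> d}" using r lm_expos by auto
    qed
  qed
  have "f \<in> N" using f lead_one_one[OF mp] J(4) by (auto simp: N_def intro!: bexI[of _ 1])
  then obtain b0 where "b0 \<in> B" using B(3) by blast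
  then have "lm ` Nd \<noteq> {}" using BNd by blast
  moreover have "lm ` Nd \<subseteq> expos n" using lm_expos by (auto simp: Nd_def)
  ultimately obtain m where m: "m \<in> lm ` Nd" "\<forall>x\<in>lm ` Nd. x \<noteq> m \<longrightarrow> \<not> refine lt x m"
    using Finite_Set.bex_min_element[OF fin refine_on(2) refine_on(1)] by blast
  then obtain r where r: "r \<in> Nd" "m = lm r" by blast
  have rN: "r \<in> N" "r \<in> mpolys n" "pdeg n r \<le> d" using r by (auto simp: Nd_def N_def)
  \<comment> \<open>Any cancellation of the leading term of \<open>r\<close> that stays in
    \<open>N\<close> and within degree \<open>d\<close> contradicts the minimality of
    \<open>m\<close>. Membership in \<open>N\<close> is required for every scalar, because the
    cancelling one is fixed only inside.\<close>
  have step: False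
    if q: "q \<in> expos n" and h: "h \<in> mpolys n" "is_lead lt h a" "lm r = q + a" "edeg n q + pdeg n h \<le> d"
      and N: "\<And>c. r - Poly_Mapping.single q c * h \<in> N" for q h a
  proof -
    define c where "c = Poly_Mapping.lookup r (q + a) / Poly_Mapping.lookup h a"
    let ?s = "r - Poly_Mapping.single q c * h"
    have "pdeg n ?s \<le> d" unfolding pdeg_le_iff
    proof
      fix k assume "k \<in> Poly_Mapping.keys ?s"
      then have "k \<in> Poly_Mapping.keys r \<or> k \<in> (+) q ` Poly_Mapping.keys h"
        using keys_diff[of r "Poly_Mapping.single q c * h"] keys_single_times[of q c h] by blast
      then show "edeg n k \<le> d"
      proof
        assume "k \<in> Poly_Mapping.keys r"
        then show ?thesis using rN(3) by (simp add: pdeg_le_iff)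
      next
        assume "k \<in> (+) q ` Poly_Mapping.keys h"
        then obtain l where "k = q + l" "l \<in> Poly_Mapping.keys h" by blast
        then show ?thesis using edeg_le_pdeg[of l h n] h(4) by (simp add: edeg_add)
      qed
    qed
    then have sNd: "?s \<in> Nd" using N by (simp add: Nd_def)
    have "lm ?s \<in> Poly_Mapping.keys ?s" using lm[OF N] by (simp add: is_lead_def)
    moreover have "is_lead lt r (q + a)" using lm[OF rN(1)] h(3) by simp
    ultimately have lower: "refine lt (lm ?s) m"
      using refine_cancel_lead[OF rN(2) _ h(1,2) q] h(3) r(2) unfolding c_def by simp
    moreover have "lm ?s \<noteq> m" using lower refine_irrefl[OF lm_expos[OF rN(1)]] r(2) by auto
    ultimately show False using m(2) sNd by blast
  qed
  obtain b where b: "b \<in> B" "\<forall>i<Suc n. v b i \<le> v r i" using B(3) rN(1) by blast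
  then have bN: "b \<in> N" "b \<in> mpolys n" using B(1) by (auto simp: N_def)
  have ecart: "pdeg n b - edeg n (lm b) \<le> pdeg n r - edeg n (lm r)"
    using b(2) by (auto simp: v_def dest: spec[of _ n])
  have "Poly_Mapping.lookup (lm b) i \<le> Poly_Mapping.lookup (lm r) i" if "i < n" for i
    using b(2)[rule_format, of i] that by (simp add: v_def)
  then obtain q where q: "q \<in> expos n" "lm r = q + lm b"
    using expo_divides[OF lm_expos[OF bN(1)] lm_expos[OF rN(1)]] by blast
  from rN obtain u where u: "u \<in> lead_one n lt" "r - u * f \<in> J" by (auto simp: N_def)
  show False
  proof (cases "q = 0")
    case True
    \<comment> \<open>Now \<open>r\<close> and \<open>b\<close> share their leading monomial, so
      \<open>g b\<close> cancels it. Since \<open>g b\<close> is in \<open>J\<close>, the multiplier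
      \<open>u\<close> is unchanged.\<close>
    show False
    proof (rule step[OF q(1) _ g(2)[OF bN(1)] q(2)])
      show "g b \<in> mpolys n" using g(1)[OF bN(1)] J(1) by blast
      show "edeg n q + pdeg n (g b) \<le> d" using d(2)[OF b(1)] True by (simp add: edeg_def)
      fix c :: 'k
      have s: "Poly_Mapping.single q c * g b \<in> J"
        by (intro J(3) mpolys_single q g(1)[OF bN(1)])
      have "r - Poly_Mapping.single q c * g b - u * f \<in> J"
        using Jdiff[OF u(2) s] by (simp add: algebra_simps)
      then show "r - Poly_Mapping.single q c * g b \<in> N"
        using u(1) rN(2) s J(1) by (auto simp: N_def intro!: mpolys_diff)
    qed
  next
    case False
    \<comment> \<open>As \<open>b\<close> itself competes in \<open>Nd\<close>, minimality excludes
      \<open>lm b\<close> below \<open>lm r\<close>; cancelling \<open>lm b\<close> shows that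
      \<open>q\<close> precedes \<open>0\<close>.\<close>
    have "lm b \<noteq> m" using False q(2) r(2) by simp
    then have "\<not> refine lt (0 + lm b) (q + lm b)" "\<not> refine lt (lm b) (lm r)"
      using m(2) BNd[OF b(1)] r(2) q(2) by auto
    then have "\<not> refine lt 0 q"
      using refine_add_iff[of 0 q "lm b"] q(1) lm_expos[OF bN(1)] by (simp add: add.commute)
    then have "refine lt q 0" using refine_total[of 0 q] False q(1) by auto
    then have lt0: "lt q 0" using expo_not_less_zero by (auto simp: refine_def)
    from bN obtain w where w: "w \<in> lead_one n lt" "b - w * f \<in> J" by (auto simp: N_def)
    show False
    proof (rule step[OF q(1) bN(2) lm[OF bN(1)] q(2)])
      \<comment> \<open>These bounds make the truncated subtractions in \<open>ecart\<close> exact,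
        so \<open>edeg n q + pdeg n b \<le> pdeg n r\<close>.\<close>
      have "edeg n (lm b) \<le> pdeg n b" "edeg n (lm r) \<le> pdeg n r"
        using lm[OF bN(1)] lm[OF rN(1)] by (auto simp: is_lead_def intro: edeg_le_pdeg)
      moreover have "edeg n (lm r) = edeg n q + edeg n (lm b)" by (simp add: q(2) edeg_add)
      ultimately show "edeg n q + pdeg n b \<le> d" using ecart rN(3) by linarith
      fix c :: 'k
      let ?t = "Poly_Mapping.single q c"
      have "?t * (b - w * f) \<in> J" by (intro J(3) mpolys_single q w)
      from Jdiff[OF u(2) this] have "r - ?t * b - (u - ?t * w) * f \<in> J"
        by (simp add: algebra_simps)
      moreover have "u - ?t * w \<in> lead_one n lt" by (rule lead_one_diff[OF u(1) w(1) q(1) lt0])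
      moreover have "r - ?t * b \<in> mpolys n"
        by (intro mpolys_diff mpolys_mult mpolys_single rN bN q)
      ultimately show "r - ?t * b \<in> N" by (auto simp: N_def)
    qed
  qed
qed

section \<open>Leading monomials in the leading ideal\<close>

text \<open>A combination of leading parts need not be the leading part of one element of
  \<open>J\<close>, but each of its components in an incomparability class is matched by such an
  element. The class of \<open>a\<close> yields \<open>g\<close>.\<close>

lemma is_lead_leading_ideal:
  fixes J :: "'k::field mpoly set"
  assumes J: "J \<subseteq> mpolys n" "\<And>p q. p \<in> J \<Longrightarrow> q \<in> J \<Longrightarrow> p + q \<in> J"
      "\<And>p q. p \<in> mpolys n \<Longrightarrow> q \<in> J \<Longrightarrow> p * q \<in> J" "0 \<in> J"
    and r: "r \<in> mpolys n" "is_lead lt r a"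
    and L: "leading_part lt r \<in> Idl\<^bsub>mpoly_ring n\<^esub> (leading_part lt ` J)"
  shows "\<exists>g\<in>J. is_lead lt g a"
proof -
  note D = monomial_preorderD[OF mp]
  \<comment> \<open>\<open>F\<close> has leading part equal to the component of \<open>h\<close> in the incomparability class of \<open>e\<close>, or
    that component vanishes and \<open>F\<close> lies entirely below \<open>e\<close>.\<close>
  define match where "match e h F \<longleftrightarrow> (\<forall>b\<in>expos n. \<not> lt b e \<longrightarrow>
    Poly_Mapping.lookup F b = (if lt e b then 0 else Poly_Mapping.lookup h b))" for e and h F :: "'k mpoly"
  \<comment> \<open>\<open>T\<close> turns out to be an ideal containing the generators of the
    leading ideal. Multiplication by a monomial moves classes, hence the quantification over all
    \<open>e\<close>.\<close>
  define T where "T = {h \<in> mpolys n. \<forall>e\<in>expos n. \<exists>F\<in>J. match e h F}"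
  have Tadd: "h + h' \<in> T" if h: "h \<in> T" "h' \<in> T" for h h'
    unfolding T_def
  proof (intro CollectI conjI ballI)
    show "h + h' \<in> mpolys n" using h by (auto simp: T_def intro: mpolys_add)
    fix e assume "e \<in> expos n"
    then obtain F F' where "F \<in> J" "match e h F" "F' \<in> J" "match e h' F'"
      using h unfolding T_def by blast
    then show "\<exists>F\<in>J. match e (h + h') F"
      by (intro bexI[of _ "F + F'"] J(2)) (auto simp: match_def lookup_add)
  qed
  have T0: "0 \<in> T" using J(4) by (auto simp: T_def match_def intro!: bexI[of _ 0])
  \<comment> \<open>If some \<open>q + b0\<close> is incomparable to \<open>e\<close>, the witness
    for \<open>b0\<close>, shifted by \<open>q\<close>, works for \<open>e\<close>. Otherwise the
    product has no component at \<open>e\<close>, and \<open>0\<close> works.\<close>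
  have Tsingle: "Poly_Mapping.single q c * h \<in> T" if h: "h \<in> T" and q: "q \<in> expos n" for q c h
    unfolding T_def
  proof (intro CollectI conjI ballI)
    let ?s = "Poly_Mapping.single q c"
    have hm: "h \<in> mpolys n" using h by (simp add: T_def)
    show "?s * h \<in> mpolys n" by (intro mpolys_mult mpolys_single q hm)
    fix e assume e: "e \<in> expos n"
    show "\<exists>F\<in>J. match e (?s * h) F"
    proof (cases "\<exists>b\<in>expos n. \<not> lt (q + b) e \<and> \<not> lt e (q + b)")
      case True
      then obtain b0 where b0: "b0 \<in> expos n" "\<not> lt (q + b0) e" "\<not> lt e (q + b0)" by blast
      obtain F where F: "F \<in> J" "match b0 h F" using h b0(1) unfolding T_def by blast
      have Fm: "F \<in> mpolys n" using F(1) J(1) by blast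
      have "match e (?s * h) (?s * F)"
        unfolding match_def
      proof (intro ballI impI)
        fix b assume b: "b \<in> expos n" "\<not> lt b e"
        show "Poly_Mapping.lookup (?s * F) b = (if lt e b then 0 else Poly_Mapping.lookup (?s * h) b)"
        proof (cases "\<exists>k\<in>expos n. b = q + k")
          case True
          then obtain k where k: "k \<in> expos n" "b = q + k" by blast
          have ex: "q + b0 \<in> expos n" "q + k \<in> expos n" using k q b0(1) expos_add by auto
          have "lt k b0 \<longleftrightarrow> lt (q + k) (q + b0)" "lt b0 k \<longleftrightarrow> lt (q + b0) (q + k)"
            using D(3)[OF k(1) b0(1) q] D(3)[OF b0(1) k(1) q] by (simp_all only: add.commute)
          moreover have "lt (q + k) (q + b0) \<longleftrightarrow> lt b e" "lt (q + b0) (q + k) \<longleftrightarrow> lt e b"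
            using lt_cotrans[OF ex(2) e ex(1)] lt_cotrans[OF ex(2,1) e]
              lt_cotrans[OF ex(1) e ex(2)] lt_cotrans[OF e ex] b0 k(2) by blast+
          ultimately show ?thesis
            using F(2) k b(2) unfolding match_def by (simp add: lookup_single_times_add)
        next
          case False
          then have "b \<notin> (+) q ` Poly_Mapping.keys F" "b \<notin> (+) q ` Poly_Mapping.keys h"
            using Fm hm by (auto simp: mpolys_def)
          then have "Poly_Mapping.lookup (?s * F) b = 0" "Poly_Mapping.lookup (?s * h) b = 0"
            using keys_single_times[of q c F] keys_single_times[of q c h]
            by (auto simp: in_keys_iff)
          then show ?thesis by simp
        qed
      qed
      then show ?thesis using J(3)[OF mpolys_single[OF q] F(1)] by blast
    next
      case False
      have "Poly_Mapping.lookup (?s * h) b = 0" if "\<not> lt b e" "\<not> lt e b" for b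
      proof -
        have "b \<notin> (+) q ` Poly_Mapping.keys h" using False that hm by (auto simp: mpolys_def)
        then show ?thesis using keys_single_times[of q c h] by (auto simp: in_keys_iff)
      qed
      then have "match e (?s * h) 0" by (simp add: match_def)
      then show ?thesis using J(4) by blast
    qed
  qed
  have Tmult: "p * h \<in> T" if "p \<in> mpolys n" "h \<in> T" for p h
  proof -
    have "(\<Sum>q\<in>K. Poly_Mapping.single q (Poly_Mapping.lookup p q) * h) \<in> T"
      if "finite K" "K \<subseteq> expos n" for K
      using that by (induction rule: finite_induct) (auto intro!: T0 Tadd Tsingle[OF \<open>h \<in> T\<close>])
    from this[OF finite_keys, of p] that(1) show ?thesis
      by (simp add: poly_mapping_sum_singles flip: sum_distrib_right, simp add: mpolys_def)
  qed
  have "ideal T (mpoly_ring n)"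
    by (rule ideal_mpoly_ringI) (use T0 Tadd Tmult in \<open>auto simp: T_def\<close>)
  moreover have "leading_part lt ` J \<subseteq> T"
  proof
    fix h assume "h \<in> leading_part lt ` J"
    then obtain f where f: "f \<in> J" "h = leading_part lt f" by blast
    have K: "Poly_Mapping.keys f \<subseteq> expos n" using f(1) J(1) by (auto simp: mpolys_def)
    have hk: "b \<in> Poly_Mapping.keys h \<longleftrightarrow>
        b \<in> Poly_Mapping.keys f \<and> \<not> (\<exists>c\<in>Poly_Mapping.keys f. lt b c)" for b
      by (simp add: f(2) in_keys_iff lookup_leading_part)
    show "h \<in> T"
      unfolding T_def
    proof (intro CollectI conjI ballI)
      show "h \<in> mpolys n" using hk K by (auto simp: mpolys_def)
      fix e assume e: "e \<in> expos n"
      show "\<exists>F\<in>J. match e h F"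
      \<comment> \<open>If \<open>e\<close> is in the class of the leading part, \<open>f\<close> is
        the witness, since its monomials not below \<open>e\<close> are those of \<open>h\<close>;
        otherwise \<open>0\<close> is.\<close>
      proof (cases "\<exists>m\<in>Poly_Mapping.keys h. \<not> lt m e \<and> \<not> lt e m")
        case True
        then obtain m where m: "m \<in> Poly_Mapping.keys h" "\<not> lt m e" "\<not> lt e m" by blast
        have le: "\<not> lt e b" if "b \<in> Poly_Mapping.keys f" for b
          using lt_cotrans[of e m b] m that hk[of m] e K by blast
        have "Poly_Mapping.lookup f b = Poly_Mapping.lookup h b" if "b \<in> expos n" "\<not> lt b e" for b
        proof (cases "b \<in> Poly_Mapping.keys f")
          case True
          have "\<not> lt b c" if "c \<in> Poly_Mapping.keys f" for c
            using lt_cotrans[of b e c] \<open>\<not> lt b e\<close> le[OF that] that True K e by blast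
          with True show ?thesis by (simp add: f(2) lookup_leading_part)
        qed (simp add: f(2) lookup_leading_part in_keys_iff)
        moreover have "Poly_Mapping.lookup f b = 0" if "lt e b" for b
          using le that by (auto simp: in_keys_iff)
        ultimately have "match e h f" unfolding match_def by metis
        then show ?thesis using f(1) by blast
      next
        case False
        then have "match e h 0" by (auto simp: match_def in_keys_iff)
        then show ?thesis using J(4) by blast
      qed
    qed
  qed
  ultimately have "Idl\<^bsub>mpoly_ring n\<^esub> (leading_part lt ` J) \<subseteq> T"
    using ring.genideal_minimal[OF cring.axioms(1)[OF cring_mpoly_ring]] by blast
  then have "leading_part lt r \<in> T" using L by blast
  moreover have aK: "a \<in> Poly_Mapping.keys r" "a \<in> expos n" using r by (auto simp: is_lead_def mpolys_def)
  ultimately obtain F where F: "F \<in> J" "match a (leading_part lt r) F" unfolding T_def by blast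
  \<comment> \<open>Thus \<open>a\<close> survives in the leading part of \<open>r\<close>, and
    \<open>F\<close> has the same nonzero coefficient there.\<close>
  have max: "\<not> lt a b" if "b \<in> Poly_Mapping.keys r" for b
  proof (cases "b = a")
    case False
    have "b \<in> expos n" using that r(1) by (auto simp: mpolys_def)
    moreover have "refine lt b a" using r(2) that False by (simp add: is_lead_def)
    ultimately show ?thesis using D(1)[OF aK(2)] D(2)[of a b a] aK(2) by (auto simp: refine_def)
  qed (use D(1)[OF aK(2)] in simp)
  have "Poly_Mapping.lookup F a = Poly_Mapping.lookup r a"
    using F(2) aK max D(1)[OF aK(2)] by (auto simp: match_def lookup_leading_part)
  then have "a \<in> Poly_Mapping.keys F" using aK by (simp add: in_keys_iff)
  moreover have "refine lt b a" if b: "b \<in> Poly_Mapping.keys F" "b \<noteq> a" for b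
  proof (cases "lt b a")
    case False
    have "b \<in> expos n" using b(1) F(1) J(1) by (auto simp: mpolys_def)
    then have "Poly_Mapping.lookup (leading_part lt r) b \<noteq> 0"
      using F(2) False b(1) by (auto simp: match_def in_keys_iff split: if_splits)
    then have "b \<in> Poly_Mapping.keys r" by (auto simp: lookup_leading_part split: if_splits)
    then show ?thesis using r(2) b(2) by (simp add: is_lead_def)
  qed (simp add: refine_def)
  ultimately show ?thesis using F(1) by (auto simp: is_lead_def)
qed

end

section \<open>Contraction to polynomials and primality\<close>

theorem theorem4p8:
  fixes n :: nat
    and lt :: "expo \<Rightarrow> expo \<Rightarrow> bool"
    and I :: "'k::field mpoly fract set"
  assumes "monomial_preorder n lt"
    and "ideal I (localization n lt)"
    and "primeideal (leading_ideal n lt I) (mpoly_ring n)"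
  shows "primeideal I (localization n lt)"
proof -
  note mp = assms(1)
  let ?R = "mpoly_ring n :: 'k mpoly ring" and ?A = "localization n lt :: 'k mpoly fract ring"
  interpret I: ideal I ?A by (rule assms(2))
  interpret L: primeideal "leading_ideal n lt I" ?R by (rule assms(3))
  have R: "carrier ?R = mpolys n" "p \<otimes>\<^bsub>?R\<^esub> q = p * q" "\<one>\<^bsub>?R\<^esub> = 1" for p q
    by (simp_all add: mpoly_ring_def ring_of_type_algebra_def)
  have A: "carrier ?A = {Fraction_Field.Fract f u | f u. f \<in> mpolys n \<and> u \<in> lead_one n lt}"
    "x \<otimes>\<^bsub>?A\<^esub> y = x * y" "x \<oplus>\<^bsub>?A\<^esub> y = x + y" "\<zero>\<^bsub>?A\<^esub> = 0" "\<one>\<^bsub>?A\<^esub> = 1" for x y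
    by (simp_all add: localization_def ring_of_type_algebra_def)
  have carrI: "Fraction_Field.Fract p u \<in> carrier ?A" if "p \<in> mpolys n" "u \<in> lead_one n lt" for p u
    using that by (auto simp: A)
  note one = lead_one_one[OF mp, where 'k = 'k]
  have S: "u \<noteq> 0" "u \<in> mpolys n" if "u \<in> lead_one n lt" for u :: "'k mpoly"
    using that lead_one_nonzero by (auto simp: lead_one_def leading_part_def)
  have times_I: "x * y \<in> I" if "x \<in> carrier ?A" "y \<in> I" for x y
    using I.I_l_closed[OF that(2,1)] by (simp add: A)
  define J where "J = {p \<in> mpolys n. Fraction_Field.Fract p 1 \<in> I}"
  \<comment> \<open>Denominators are units of the localization: multiply by \<open>u\<close> in one
    direction and by its inverse in the other.\<close>
  have mem: "Fraction_Field.Fract p u \<in> I \<longleftrightarrow> p \<in> J" if "p \<in> mpolys n" "u \<in> lead_one n lt" for p u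
  proof
    assume "Fraction_Field.Fract p u \<in> I"
    then have "Fraction_Field.Fract u 1 * Fraction_Field.Fract p u \<in> I"
      by (intro times_I carrI S that one)
    moreover have "Fraction_Field.Fract u 1 * Fraction_Field.Fract p u = Fraction_Field.Fract p 1"
      using S(1)[OF that(2)] by (simp add: Fraction_Field.eq_fract mult.commute)
    ultimately show "p \<in> J" using that by (simp add: J_def)
  next
    assume "p \<in> J"
    then have "Fraction_Field.Fract 1 u * Fraction_Field.Fract p 1 \<in> I"
      by (intro times_I carrI that mpolys_one) (simp add: J_def)
    then show "Fraction_Field.Fract p u \<in> I" by simp
  qed
  have "loc_leading_part n lt ` I = leading_part lt ` J"
  proof (intro equalityI subsetI)
    fix h assume "h \<in> loc_leading_part n lt ` I"
    then obtain x where x: "x \<in> I" "h = loc_leading_part n lt x" by blast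
    then obtain f u where f: "x = Fraction_Field.Fract f u" "f \<in> mpolys n" "u \<in> lead_one n lt"
      using I.Icarr[OF x(1)] by (auto simp: A)
    then show "h \<in> leading_part lt ` J"
      using x mem[OF f(2,3)] loc_leading_part_Fract[OF mp f(3,2)] by auto
  next
    fix h assume "h \<in> leading_part lt ` J"
    then obtain p where "p \<in> mpolys n" "Fraction_Field.Fract p 1 \<in> I" "h = leading_part lt p"
      by (auto simp: J_def)
    then show "h \<in> loc_leading_part n lt ` I"
      using loc_leading_part_Fract[OF mp one] by (intro image_eqI) auto
  qed
  then have L: "leading_ideal n lt I = Idl\<^bsub>?R\<^esub> (leading_part lt ` J)"
    by (simp add: leading_ideal_def)
  have lp_mpolys: "leading_part lt p \<in> mpolys n" if "p \<in> mpolys n" for p :: "'k mpoly"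
    using that by (auto simp: mpolys_def subset_iff in_keys_iff lookup_leading_part split: if_splits)
  have lead_J: "leading_part lt p \<in> leading_ideal n lt I" if "p \<in> J" for p
  proof -
    have "leading_part lt ` J \<subseteq> carrier ?R" using lp_mpolys by (auto simp: R J_def)
    from L.genideal_self[OF this] that show ?thesis by (auto simp: L)
  qed
  note I_sub = ideal.axioms(1)[OF assms(2)]
  have J: "J \<subseteq> mpolys n" "0 \<in> J"
    using additive_subgroup.zero_closed[OF I_sub] by (auto simp: J_def A Fraction_Field.Zero_fract_def)
  have Jadd: "p + q \<in> J" if "p \<in> J" "q \<in> J" for p q
    using additive_subgroup.a_closed[OF I_sub, of "Fraction_Field.Fract p 1" "Fraction_Field.Fract q 1"] that
    by (simp add: J_def A mpolys_add)
  have Jmult: "p * q \<in> J" if "p \<in> mpolys n" "q \<in> J" for p q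
    using times_I[OF carrI[OF that(1) one], of "Fraction_Field.Fract q 1"] that
    by (simp add: J_def mpolys_mult)
  have Jsat: "p \<in> J" if "u \<in> lead_one n lt" "p \<in> mpolys n" "u * p \<in> J" for u p
  proof -
    have "Fraction_Field.Fract (u * p) u \<in> I"
      using mem[of "u * p" u] that S by (simp add: mpolys_mult)
    moreover have "Fraction_Field.Fract (u * p) u = Fraction_Field.Fract p 1"
      using S(1)[OF that(1)] by (simp add: Fraction_Field.eq_fract mult.commute)
    ultimately show ?thesis using that by (simp add: J_def)
  qed
  have outside: "\<exists>r\<in>mpolys n. \<exists>u\<in>lead_one n lt. r - u * f \<in> J \<and> leading_part lt r \<notin> leading_ideal n lt I"
    if f: "f \<in> mpolys n" "f \<notin> J" for f
  proof -
    have "\<exists>r\<in>mpolys n. r \<noteq> 0 \<and> (\<exists>u\<in>lead_one n lt. r - u * f \<in> J) \<and>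
        (\<forall>a. is_lead lt r a \<longrightarrow> \<not> (\<exists>g\<in>J. is_lead lt g a))"
      by (rule ex_lead_not_in[OF mp J(1) _ _ J(2) _ f]) (fact Jadd Jmult Jsat)+
    then obtain r u
      where r: "r \<in> mpolys n" "r \<noteq> 0" and u: "u \<in> lead_one n lt" "r - u * f \<in> J"
        and no: "\<forall>a. is_lead lt r a \<longrightarrow> \<not> (\<exists>g\<in>J. is_lead lt g a)"
      by (elim bexE conjE)
    from is_lead_exists[OF mp r] obtain a where a: "is_lead lt r a" by (elim exE)
    have "leading_part lt r \<notin> leading_ideal n lt I"
    proof
      assume in_L: "leading_part lt r \<in> leading_ideal n lt I"
      have "\<exists>g\<in>J. is_lead lt g a"
        by (rule is_lead_leading_ideal[OF mp J(1) _ _ J(2) r(1) a in_L[unfolded L]]) (fact Jadd Jmult)+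
      with no a show False by simp
    qed
    with r(1) u show ?thesis by (intro bexI[of _ r] bexI[of _ u] conjI)
  qed
  show ?thesis
  proof (rule primeidealI[OF assms(2) cring_localization[OF mp]])
    show "carrier ?A \<noteq> I"
    proof
      assume "carrier ?A = I"
      \<comment> \<open>An improper \<open>I\<close> would contain \<open>1\<close>, whose leading
        part \<open>1\<close> would make the leading ideal improper.\<close>
      then have "1 \<in> J" using carrI[OF mpolys_one one] by (simp add: J_def)
      then have "1 \<in> leading_ideal n lt I"
        using lead_J one by (fastforce simp: lead_one_def)
      then show False using L.one_imp_carrier L.I_notcarr by (simp add: R)
    qed
    fix x y assume "x \<in> carrier ?A" "y \<in> carrier ?A" and xy: "x \<otimes>\<^bsub>?A\<^esub> y \<in> I"
    then obtain f u g v where x: "x = Fraction_Field.Fract f u" "f \<in> mpolys n" "u \<in> lead_one n lt"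
      and y: "y = Fraction_Field.Fract g v" "g \<in> mpolys n" "v \<in> lead_one n lt"
      by (auto simp: A)
    have "Fraction_Field.Fract (f * g) (u * v) \<in> I" using xy by (simp add: A x y)
    then have fg: "f * g \<in> J"
      using mem[OF mpolys_mult[OF x(2) y(2)] lead_one_mult[OF mp x(3) y(3)]] by blast
    have "f \<in> J \<or> g \<in> J"
    proof (rule ccontr)
      assume "\<not> (f \<in> J \<or> g \<in> J)"
      then have nf: "f \<notin> J" and ng: "g \<notin> J" by auto
      obtain r w where r: "r \<in> mpolys n" "w \<in> lead_one n lt" "r - w * f \<in> J"
        "leading_part lt r \<notin> leading_ideal n lt I" using outside[OF x(2) nf] by blast
      obtain s z where s: "s \<in> mpolys n" "z \<in> lead_one n lt" "s - z * g \<in> J"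
        "leading_part lt s \<notin> leading_ideal n lt I" using outside[OF y(2) ng] by blast
      \<comment> \<open>Modulo \<open>J\<close>, \<open>r\<close> is \<open>w * f\<close> and
        \<open>s\<close> is \<open>z * g\<close>, so \<open>r * s\<close> is a multiple of
        \<open>f * g\<close>.\<close>
      have "r * s = s * (r - w * f) + (w * f) * (s - z * g) + (w * z) * (f * g)"
        by (simp add: algebra_simps)
      also have "\<dots> \<in> J"
        by (intro Jadd Jmult mpolys_mult r s x y S fg)
      finally have "leading_part lt r * leading_part lt s \<in> leading_ideal n lt I"
        using lead_J leading_part_mult[OF mp r(1) s(1)] by fastforce
      then show False
        using L.I_prime[of "leading_part lt r" "leading_part lt s"] r(4) s(4)
          lp_mpolys[OF r(1)] lp_mpolys[OF s(1)] by (simp add: R)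
    qed
    then show "x \<in> I \<or> y \<in> I" using mem[OF x(2,3)] mem[OF y(2,3)] x(1) y(1) by blast
  qed
qed

end
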